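(* Let $(x_n)_{n\in\mathbb{N}}$ be a nonincreasing sequence of positive real numbers with $\sum_{n=1}^{\infty}x_n<\infty$. Suppose that the set $E(x_n)$ contains a nondegenerate interval (equivalently, $E(x_n)$ is a Cantorval or a finite union of closed intervals). Then the set $U(x_n)$ has empty interior in $\mathbb{R}$.
   Context: $\mathbb{N}=\{1,2,\dots\}$. $E(x_n)=\{\sum_{n\in A}x_n : A\subset\mathbb{N}\}$ is the set of all subsums of the series. $U(x_n)\subset E(x_n)$ is the set of all points with unique representation: $x\in U(x_n)$ iff there is exactly one set $A\subset\mathbb{N}$ with $x=\sum_{n\in A}x_n$. A Cantorval is a subset of $\mathbb{R}$ homeomorphic to $E(y_n)$ where $y_{2n-1}=\frac{3}{4^n}$, $y_{2n}=\frac{2}{4^n}$ for $n\in\mathbb{N}$. *)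

theory Defs
  imports "HOL-Analysis.Analysis"
begin

text \<open>
  Sequences are indexed by the positive integers, that is, by the set \<open>{1..}\<close> of natural
  numbers; the value \<open>x 0\<close> plays no role.  Sums over subsets are unordered sums
  \<open>infsum\<close>, which agree with the usual series since all terms are positive and summable.
\<close>

definition subsums :: "(nat \<Rightarrow> real) \<Rightarrow> real set" where
  "subsums x = {infsum x A | A. A \<subseteq> {1..}}"

definition unique_subsums :: "(nat \<Rightarrow> real) \<Rightarrow> real set" where
  "unique_subsums x = {s \<in> subsums x. \<exists>!A. A \<subseteq> {1..} \<and> s = infsum x A}"

end

theory Submission
  imports Defs
begin

text \<open>
  The statement is a topological one.  Encode an index set \<open>A\<close> by its characteristic function, so
  that the index sets form the compact product space \<open>nat \<Rightarrow> bool\<close>.  The map sending an index set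
  to its subsum is continuous, because by the Weierstrass M-test it is a uniform limit of finite
  sums of coordinate functions (\<open>continuous_on_subsum\<close>).  Hence, for each index \<open>n\<close>, the subsums
  that use \<open>n\<close> form a compact set, and so do the subsums that avoid \<open>n\<close> (\<open>compact_subsums_coordinate\<close>).

  Suppose that all points of a nondegenerate interval \<open>{s..t}\<close> have a unique representation.
  The representations of \<open>s\<close> and \<open>t\<close> differ at some index \<open>n\<close>.  The two compact sets belonging to
  this \<open>n\<close> cover \<open>{s..t}\<close>, both meet it, and by uniqueness they have no common point in it.
  This contradicts the connectedness of the interval.
\<close>

lemma continuous_on_subsum:
  fixes x :: "'i \<Rightarrow> real"
  assumes "x summable_on I"
  shows "continuous_on UNIV (\<lambda>f :: 'i \<Rightarrow> bool. infsum x {i \<in> I. f i})"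
proof -
  define h where "h i f = (if f i then x i else 0)" for i and f :: "'i \<Rightarrow> bool"
  have h_cont: "continuous_on UNIV (h i)" for i
  proof -
    have "continuous_on UNIV (\<lambda>b. if b then x i else 0)"
      by simp
    then have "continuous_on UNIV ((\<lambda>b. if b then x i else 0) \<circ> (\<lambda>f :: 'i \<Rightarrow> bool. f i))"
      by (intro continuous_on_compose continuous_on_product_coordinates)
        (auto intro: continuous_on_subset)
    then show ?thesis
      by (simp add: h_def[abs_def] o_def)
  qed
  have "(\<lambda>i. norm (x i)) summable_on I"
    using assms summable_on_iff_abs_summable_on_real by blast
  then have "uniform_limit UNIV (\<lambda>F f. \<Sum>i\<in>F. h i f) (\<lambda>f. infsum (\<lambda>i. h i f) I)
      (finite_subsets_at_top I)"
    by (intro Weierstrass_m_test_general[where M = "\<lambda>i. norm (x i)"]) (auto simp: h_def)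
  then have "continuous_on UNIV (\<lambda>f. infsum (\<lambda>i. h i f) I)"
    by (rule uniform_limit_theorem[rotated])
      (auto intro!: continuous_on_sum h_cont always_eventually)
  moreover have "infsum (\<lambda>i. h i f) I = infsum x {i \<in> I. f i}" for f
    by (rule infsum_cong_neutral) (auto simp: h_def)
  ultimately show ?thesis
    by simp
qed

lemma compact_bool_functions: "compact (UNIV :: ('i \<Rightarrow> bool) set)"
proof -
  have "compact_space (product_topology (\<lambda>i :: 'i. euclidean :: bool topology) UNIV)"
    unfolding compact_space_product_topology by (simp add: compact_space_def finite_imp_compact)
  then show ?thesis
    unfolding euclidean_product_topology by (simp add: compact_space_def)
qed

lemma compact_subsums_coordinate:
  fixes x :: "'i \<Rightarrow> real"
  assumes "x summable_on I" and "n \<in> I"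
  shows "compact {infsum x A | A. A \<subseteq> I \<and> (n \<in> A \<longleftrightarrow> b)}"
proof -
  let ?\<phi> = "\<lambda>f :: 'i \<Rightarrow> bool. infsum x {i \<in> I. f i}"
  have compact_image: "compact (?\<phi> ` ((\<lambda>f. f n) -` {b}))"
  proof (intro compact_continuous_image)
    show "continuous_on ((\<lambda>f. f n) -` {b}) ?\<phi>"
      using continuous_on_subset[OF continuous_on_subsum[OF assms(1)]] by blast
    have "closed ((\<lambda>f :: 'i \<Rightarrow> bool. f n) -` {b})"
      by (intro closed_vimage continuous_on_product_coordinates) simp
    then show "compact ((\<lambda>f :: 'i \<Rightarrow> bool. f n) -` {b})"
      using compact_Int_closed[OF compact_bool_functions] by fastforce
  qed
  have "{infsum x A | A. A \<subseteq> I \<and> (n \<in> A \<longleftrightarrow> b)} = ?\<phi> ` ((\<lambda>f. f n) -` {b})"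
  proof (intro equalityI subsetI)
    fix s assume "s \<in> {infsum x A | A. A \<subseteq> I \<and> (n \<in> A \<longleftrightarrow> b)}"
    then obtain A where A: "A \<subseteq> I" "n \<in> A \<longleftrightarrow> b" and s: "s = infsum x A"
      by blast
    have "{i \<in> I. i \<in> A} = A"
      using A by blast
    then show "s \<in> ?\<phi> ` ((\<lambda>f. f n) -` {b})"
      using A s by (intro image_eqI[where x = "\<lambda>i. i \<in> A"]) auto
  qed (use \<open>n \<in> I\<close> in blast)
  then show ?thesis
    using compact_image by simp
qed

theorem theorem3p2:
  fixes x :: "nat \<Rightarrow> real"
  assumes pos: "\<And>n. n \<ge> 1 \<Longrightarrow> x n > 0"
    and nonincreasing: "\<And>m n. 1 \<le> m \<Longrightarrow> m \<le> n \<Longrightarrow> x n \<le> x m"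
    and summable: "x summable_on {1..}"
    and contains_interval: "\<exists>a b. a < b \<and> {a..b} \<subseteq> subsums x"
  shows "interior (unique_subsums x) = {}"
proof (rule ccontr)
  assume "interior (unique_subsums x) \<noteq> {}"
  then obtain s where "s \<in> interior (unique_subsums x)"
    by blast
  then obtain e where "e > 0" and ball: "cball s e \<subseteq> unique_subsums x"
    by (auto simp: mem_interior_cball)
  define t where "t = s + e"
  have "s < t" and interval: "{s..t} \<subseteq> unique_subsums x"
    using \<open>e > 0\<close> ball by (auto simp: t_def cball_eq_atLeastAtMost)
  then have "s \<in> unique_subsums x" "t \<in> unique_subsums x"
    by auto
  then obtain A B where A: "A \<subseteq> {1..}" "s = infsum x A" and B: "B \<subseteq> {1..}" "t = infsum x B"
    by (auto simp: unique_subsums_def)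
  with \<open>s < t\<close> have "A \<noteq> B"
    by auto
  then obtain n where n: "n \<in> A \<longleftrightarrow> n \<notin> B"
    by blast
  then have "n \<in> {1..}"
    using A B by blast
  define K where "K b = {infsum x C | C. C \<subseteq> {1..} \<and> (n \<in> C \<longleftrightarrow> b)}" for b
  have closed: "closed (K b)" for b
    unfolding K_def by (intro compact_imp_closed compact_subsums_coordinate summable \<open>n \<in> {1..}\<close>)
  have cover: "{s..t} \<subseteq> K True \<union> K False"
  proof
    fix u assume "u \<in> {s..t}"
    then obtain C where "C \<subseteq> {1..}" "u = infsum x C"
      using interval by (auto simp: unique_subsums_def)
    then have "u \<in> K (n \<in> C)"
      by (auto simp: K_def)
    then show "u \<in> K True \<union> K False"
      by (cases "n \<in> C") auto
  qed
  have disjoint: "K True \<inter> K False \<inter> {s..t} = {}"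
  proof (rule equals0I)
    fix u assume u: "u \<in> K True \<inter> K False \<inter> {s..t}"
    then obtain C D where "C \<subseteq> {1..} \<and> u = infsum x C" "n \<in> C"
        and "D \<subseteq> {1..} \<and> u = infsum x D" "n \<notin> D"
      unfolding K_def by blast
    moreover have "\<exists>!C. C \<subseteq> {1..} \<and> u = infsum x C"
      using u interval unfolding unique_subsums_def by blast
    ultimately show False
      by metis
  qed
  have "s \<in> K (n \<in> A)" "t \<in> K (n \<in> B)"
    using A B by (auto simp: K_def)
  then have "K True \<inter> {s..t} \<noteq> {}" "K False \<inter> {s..t} \<noteq> {}"
    using n \<open>s < t\<close> by (auto simp: disjoint_iff)
  then show False
    using connected_closedD[of "{s..t}" "K True" "K False"] closed cover disjoint by simp
qed

end
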